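(* There are exactly ten combinatorial types of degree-$3$ tropical rational maps $\mathbb{T}\mathbb{P}^1\to\mathbb{T}\mathbb{P}^1$, up to reversal of the source. They are given by the following slope sequences $(s_0,\dots,s_k)$, where $k$ is the number of break points: - $k=4$: $(3,4,5,4,3)$, $(3,4,3,4,3)$, $(3,4,3,2,3)$, $(3,2,3,2,3)$, $(3,2,1,2,3)$; - $k=3$: $(3,5,4,3)$, $(3,1,2,3)$, $(3,4,2,3)$; - $k=2$: $(3,5,3)$, $(3,1,3)$.
   Context: The tropical projective line is $\mathbb{T}\mathbb{P}^1=\mathbb{R}\cup\{-\infty,+\infty\}$. A degree-$3$ tropical rational map is a continuous piecewise-linear function $\varphi:\mathbb{R}\to\mathbb{R}$ (extended continuously to $\mathbb{T}\mathbb{P}^1\to\mathbb{T}\mathbb{P}^1$) with integer slopes and finitely many break points $x_1<\dots<x_k$ (points where the slope changes). Its slope sequence is $(s_0,\dots,s_k)$, where $s_i$ is the slope on $(x_i,x_{i+1})$, with $x_0=-\infty$, $x_{k+1}=+\infty$; thus $s_i\neq s_{i-1}$ for $1\le i\le k$. The slope sequence is required to satisfy: (i) $s_0=s_k=3$; (ii) $s_i\in\mathbb{Z}$ for all $i$; (iii) (Riemann--Hurwitz constraint) $\sum_{i=1}^k|s_i-s_{i-1}|=4$. Two slope sequences are equivalent if they are equal or differ by reversing the order, $(s_0,\dots,s_k)\sim(s_k,\dots,s_0)$. The combinatorial type of $\varphi$ is the equivalence class of its slope sequence. *)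

theory Defs
  imports "HOL-Analysis.Analysis"
begin

text \<open>The tropical projective line is the type \<^typ>\<open>ereal\<close> with its order topology, i.e. the
  two-point compactification of the real line.\<close>

definition real_part :: "(ereal \<Rightarrow> ereal) \<Rightarrow> real \<Rightarrow> real" where
  "real_part F x = real_of_ereal (F (ereal x))"

text \<open>Break points are the points around which the function is not affine.\<close>

definition break_points :: "(real \<Rightarrow> real) \<Rightarrow> real set" where
  "break_points \<phi> = {x. \<not> (\<exists>s c. eventually (\<lambda>y. \<phi> y = s * y + c) (nhds x))}"

text \<open>For \<open>xs = [x\<^sub>1, \<dots>, x\<^sub>k]\<close> and \<open>i \<le> k\<close>, the following is the open interval from \<open>x\<^sub>i\<close> to
  \<open>x\<^sub>i\<^sub>+\<^sub>1\<close>, where \<open>x\<^sub>0 = -\<infinity>\<close> and \<open>x\<^sub>k\<^sub>+\<^sub>1 = +\<infinity>\<close>; list positions start at \<open>0\<close>, so \<open>x\<^sub>i\<close> is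
  \<open>xs ! (i - 1)\<close>.\<close>

definition piece :: "real list \<Rightarrow> nat \<Rightarrow> real set" where
  "piece xs i = {x. (0 < i \<longrightarrow> xs ! (i - 1) < x) \<and> (i < length xs \<longrightarrow> x < xs ! i)}"

text \<open>For continuous functions, consecutive entries of a slope sequence are automatically distinct,
  since the points separating the pieces are exactly the break points.\<close>

definition has_slope_sequence :: "(real \<Rightarrow> real) \<Rightarrow> int list \<Rightarrow> bool" where
  "has_slope_sequence \<phi> ss \<longleftrightarrow>
     finite (break_points \<phi>) \<and>
     length ss = card (break_points \<phi>) + 1 \<and>
     (\<forall>i \<le> card (break_points \<phi>). \<exists>c.
        \<forall>x \<in> piece (sorted_list_of_set (break_points \<phi>)) i. \<phi> x = of_int (ss ! i) * x + c)"

lemma piece_two_points: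
  assumes "sorted_wrt (<) xs" "i \<le> length xs"
  obtains x y where "x \<in> piece xs i" "y \<in> piece xs i" "x < y"
proof -
  consider "i = 0" "xs = []" | "i = 0" "0 < length xs" | "0 < i" "i = length xs"
    | "0 < i" "i < length xs"
    using assms(2) by fastforce
  then show thesis
  proof cases
    case 1
    then show thesis using that[of 0 1] by (simp add: piece_def)
  next
    case 2
    then show thesis using that[of "xs ! 0 - 2" "xs ! 0 - 1"] by (simp add: piece_def)
  next
    case 3
    then show thesis using that[of "xs ! (i - 1) + 1" "xs ! (i - 1) + 2"] by (simp add: piece_def)
  next
    case 4
    then have "xs ! (i - 1) < xs ! i"
      using assms(1) by (intro sorted_wrt_nth_less) auto
    then obtain y where y: "xs ! (i - 1) < y" "y < xs ! i" using dense by blast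
    then obtain x where "xs ! (i - 1) < x" "x < y" using dense by blast
    with y show thesis using that[of x y] by (simp add: piece_def)
  qed
qed

lemma has_slope_sequence_unique:
  assumes "has_slope_sequence \<phi> ss" "has_slope_sequence \<phi> ts"
  shows "ss = ts"
proof (rule nth_equalityI)
  show "length ss = length ts" using assms by (simp add: has_slope_sequence_def)
next
  fix i assume "i < length ss"
  define xs where "xs = sorted_list_of_set (break_points \<phi>)"
  have i: "i \<le> card (break_points \<phi>)"
    using \<open>i < length ss\<close> assms(1) by (simp add: has_slope_sequence_def)
  then have "i \<le> length xs" by (simp add: xs_def)
  moreover have "sorted_wrt (<) xs" by (simp add: xs_def)
  ultimately obtain x y where xy: "x \<in> piece xs i" "y \<in> piece xs i" "x < y"
    using piece_two_points by blast
  obtain c where c: "\<forall>x \<in> piece xs i. \<phi> x = of_int (ss ! i) * x + c"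
    using assms(1) i unfolding has_slope_sequence_def xs_def by blast
  obtain d where d: "\<forall>x \<in> piece xs i. \<phi> x = of_int (ts ! i) * x + d"
    using assms(2) i unfolding has_slope_sequence_def xs_def by blast
  have "of_int (ss ! i) * (y - x) = \<phi> y - \<phi> x" using c xy by (simp add: algebra_simps)
  also have "\<dots> = of_int (ts ! i) * (y - x)" using d xy by (simp add: algebra_simps)
  finally show "ss ! i = ts ! i" using xy(3) by simp
qed

definition slope_sequence :: "(ereal \<Rightarrow> ereal) \<Rightarrow> int list" where
  "slope_sequence F = (THE ss. has_slope_sequence (real_part F) ss)"

lemma slope_sequence_eq: "has_slope_sequence (real_part F) ss \<Longrightarrow> slope_sequence F = ss"
  unfolding slope_sequence_def by (blast intro: has_slope_sequence_unique)

text \<open>Continuity of \<open>F\<close> on the whole type includes continuity of its real part on \<open>\<real>\<close>, and it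
  determines the values of \<open>F\<close> at the two infinite points.\<close>

definition tropical_rational_map3 :: "(ereal \<Rightarrow> ereal) \<Rightarrow> bool" where
  "tropical_rational_map3 F \<longleftrightarrow>
     continuous_on UNIV F \<and>
     (\<forall>x::real. F (ereal x) \<in> range ereal) \<and>
     (\<exists>ss. has_slope_sequence (real_part F) ss \<and>
        hd ss = 3 \<and> last ss = 3 \<and>
        (\<Sum>i = 1..<length ss. \<bar>ss ! i - ss ! (i - 1)\<bar>) = 4)"

definition reversal_equiv :: "(int list \<times> int list) set" where
  "reversal_equiv = {(ss, ts). ts = ss \<or> ts = rev ss}"

lemma equiv_reversal_equiv: "equiv UNIV reversal_equiv"
  by (auto simp: reversal_equiv_def equiv_def refl_on_def sym_def trans_def)

definition combinatorial_type :: "(ereal \<Rightarrow> ereal) \<Rightarrow> int list set" where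
  "combinatorial_type F = reversal_equiv `` {slope_sequence F}"

definition types_with_breaks :: "nat \<Rightarrow> int list set set" where
  "types_with_breaks k =
     combinatorial_type ` {F. tropical_rational_map3 F \<and> card (break_points (real_part F)) = k}"

end

theory Submission
  imports Defs
begin

text \<open>A continuous piecewise affine function breaks exactly where the slopes on the two sides differ
  (\<open>break_point_iff_slope_change\<close>). Hence the slope sequence of a continuous function never repeats
  a value in adjacent positions. Conversely, any nonempty integer sequence without adjacent
  repetitions is the slope sequence of some continuous function, for instance of
  \<open>s\<^sub>0 x + \<Sum>\<^sub>j (s\<^sub>j - s\<^sub>j\<^sub>-\<^sub>1) max 0 (x - j)\<close>; if both outer slopes are positive, this function tends
  to \<open>\<plusminus>\<infinity>\<close> at \<open>\<plusminus>\<infinity>\<close> and so extends continuously to the tropical line. The classification of maps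
  is thereby the classification of integer sequences from \<open>3\<close> to \<open>3\<close> whose jumps are nonzero and
  have absolute values adding up to \<open>4\<close> (\<open>types_eq_quotient\<close>).

  The jumps of such a sequence add up to \<open>0\<close>, so the positive ones add up to \<open>2\<close> and the negative
  ones to \<open>-2\<close>. Each of these two amounts is either one jump of size two or two jumps of size one.
  With four breaks the jumps are therefore \<open>1, 1, -1, -1\<close> in one of six orders, with three breaks
  they are \<open>2, -1, -1\<close> or \<open>-2, 1, 1\<close> in one of three orders each, and with two breaks \<open>2, -2\<close> in one
  of two orders. Reversing the sequence reverses the order of the jumps and negates them; this
  identifies one pair of sequences with four breaks and the six sequences with three breaks in
  pairs, and it fixes all the others, which leaves \<open>5 + 3 + 2 = 10\<close> classes.\<close>

section \<open>Break points of piecewise affine functions\<close>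

text \<open>Both sides of the formula are the limit of \<open>\<phi>\<close> along \<open>F\<close>. The filter is left open so that one proof
  covers the left and the right neighbourhoods of \<open>x\<close>.\<close>

lemma isCont_affine_near_value:
  fixes \<phi> :: "real \<Rightarrow> real"
  assumes "isCont \<phi> x" "F \<le> at x" "F \<noteq> bot"
    and ev: "eventually (\<lambda>y. \<phi> y = a * y + c) F"
  shows "\<phi> x = a * x + c"
proof -
  have "(\<phi> \<longlongrightarrow> \<phi> x) F"
    using assms(1,2) unfolding isCont_def by (blast intro: tendsto_mono)
  then have "((\<lambda>y. a * y + c) \<longlongrightarrow> \<phi> x) F"
    using tendsto_cong[OF ev] by blast
  moreover have "((\<lambda>y. a * y + c) \<longlongrightarrow> a * x + c) F"
    using assms(2) by (intro tendsto_intros) (simp add: tendsto_ident_at tendsto_mono)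
  ultimately show ?thesis using assms(3) tendsto_unique by blast
qed

text \<open>Two affine functions that agree on \<open>F\<close> agree at \<open>x\<close> by continuity, and they agree at some other
  point because \<open>F\<close> is nontrivial and does not see \<open>x\<close> itself; two points determine the slope.\<close>

lemma affine_near_slope_unique:
  fixes a b c d x :: real
  assumes F: "F \<le> at x" "F \<noteq> bot"
    and ev: "eventually (\<lambda>y. a * y + c = b * y + d) F"
  shows "a = b"
proof -
  have "a * x + c = b * x + d"
    using isCont_affine_near_value[OF _ F ev] by simp
  moreover have "eventually (\<lambda>y. y \<noteq> x) F"
    using F(1) by (rule filter_leD) (simp add: eventually_at_filter)
  then have "eventually (\<lambda>y. a * y + c = b * y + d \<and> y \<noteq> x) F"
    using ev by (simp add: eventually_conj_iff)
  then obtain y where "a * y + c = b * y + d" "y \<noteq> x"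
    using eventually_happens'[OF F(2)] by blast
  ultimately have "(a - b) * (y - x) = 0" "y - x \<noteq> 0" by (simp_all add: algebra_simps)
  then show ?thesis by simp
qed

text \<open>Continuity is what matters here: it makes both one-sided formulas hold at \<open>x\<close>, so equal slopes
  force equal constants, and the two formulas merge into one around \<open>x\<close>.\<close>

lemma break_point_iff_slope_change:
  fixes \<phi> :: "real \<Rightarrow> real"
  assumes cont: "isCont \<phi> x"
    and left: "eventually (\<lambda>y. \<phi> y = a * y + c) (at_left x)"
    and right: "eventually (\<lambda>y. \<phi> y = b * y + d) (at_right x)"
  shows "x \<in> break_points \<phi> \<longleftrightarrow> a \<noteq> b"
proof -
  have le: "at_left x \<le> at x" "at_right x \<le> at x" by (simp_all add: at_le)
  have xl: "\<phi> x = a * x + c"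
    using isCont_affine_near_value[OF cont le(1) _ left] by simp
  have xr: "\<phi> x = b * x + d"
    using isCont_affine_near_value[OF cont le(2) _ right] by simp
  show ?thesis
  proof
    assume x: "x \<in> break_points \<phi>"
    show "a \<noteq> b"
    proof
      assume "a = b"
      with xl xr have "c = d" by simp
      have "eventually (\<lambda>y. \<phi> y = a * y + c) (at x)"
        unfolding eventually_at_split using left right \<open>a = b\<close> \<open>c = d\<close> by simp
      then have "eventually (\<lambda>y. \<phi> y = a * y + c) (nhds x)"
        using xl by (simp add: eventually_nhds_conv_at)
      with x show False by (auto simp: break_points_def)
    qed
  next
    assume "a \<noteq> b"
    show "x \<in> break_points \<phi>"
    proof (rule ccontr)
      assume "x \<notin> break_points \<phi>"
      then obtain s t where "eventually (\<lambda>y. \<phi> y = s * y + t) (nhds x)"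
        by (auto simp: break_points_def)
      then have st: "eventually (\<lambda>y. \<phi> y = s * y + t) (at_left x)"
        "eventually (\<lambda>y. \<phi> y = s * y + t) (at_right x)"
        by (simp_all add: eventually_nhds_conv_at eventually_at_split)
      have "eventually (\<lambda>y. s * y + t = a * y + c) (at_left x)"
        using st(1) left by (rule eventually_elim2) simp
      then have "s = a"
        by (rule affine_near_slope_unique[OF le(1) trivial_limit_at_left_real])
      moreover have "eventually (\<lambda>y. s * y + t = b * y + d) (at_right x)"
        using st(2) right by (rule eventually_elim2) simp
      then have "s = b"
        by (rule affine_near_slope_unique[OF le(2) trivial_limit_at_right_real])
      ultimately show False using \<open>a \<noteq> b\<close> by simp
    qed
  qed
qed

lemma eventually_at_left_piece:
  assumes "sorted_wrt (<) xs" "i < length xs"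
  shows "eventually (\<lambda>y. y \<in> piece xs i) (at_left (xs ! i))"
proof -
  have "eventually (\<lambda>y. 0 < i \<longrightarrow> xs ! (i - 1) < y) (at_left (xs ! i))"
  proof (cases "0 < i")
    case True
    then have "xs ! (i - 1) < xs ! i" using assms by (intro sorted_wrt_nth_less) auto
    from order_tendstoD(1)[OF tendsto_ident_at this] show ?thesis
      by (rule eventually_mono) simp
  qed simp
  moreover have "eventually (\<lambda>y. y \<in> {xs ! i - 1<..<xs ! i}) (at_left (xs ! i))"
    by (rule eventually_at_left_real) simp
  ultimately show ?thesis by (rule eventually_elim2) (simp add: piece_def)
qed

lemma eventually_at_right_piece:
  assumes "sorted_wrt (<) xs" "i < length xs"
  shows "eventually (\<lambda>y. y \<in> piece xs (Suc i)) (at_right (xs ! i))"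
proof -
  have "eventually (\<lambda>y. Suc i < length xs \<longrightarrow> y < xs ! Suc i) (at_right (xs ! i))"
  proof (cases "Suc i < length xs")
    case True
    then have "xs ! i < xs ! Suc i" using assms by (intro sorted_wrt_nth_less) auto
    from order_tendstoD(2)[OF tendsto_ident_at this] show ?thesis
      by (rule eventually_mono) simp
  qed simp
  moreover have "eventually (\<lambda>y. y \<in> {xs ! i<..<xs ! i + 1}) (at_right (xs ! i))"
    by (rule eventually_at_right_real) simp
  ultimately show ?thesis by (rule eventually_elim2) (simp add: piece_def)
qed

lemma open_piece: "open (piece xs i)"
proof -
  have "piece xs i = (if 0 < i then {xs ! (i - 1)<..} else UNIV) \<inter>
      (if i < length xs then {..<xs ! i} else UNIV)"
    by (auto simp: piece_def)
  moreover have "open \<dots>" by (rule open_Int) simp_all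
  ultimately show ?thesis by simp
qed

text \<open>The piece containing \<open>x\<close> ends at the first separating point that is not below \<open>x\<close>.\<close>

lemma in_some_piece:
  assumes "x \<notin> set xs"
  obtains i where "i \<le> length xs" "x \<in> piece xs i"
proof -
  define P where "P i \<longleftrightarrow> i = length xs \<or> x \<le> xs ! i" for i
  define i where "i = (LEAST i. P i)"
  have "P (length xs)" by (simp add: P_def)
  then have "P i" and le: "i \<le> length xs" unfolding i_def by (rule LeastI, rule Least_le)
  have "x < xs ! i" if "i < length xs"
    using \<open>P i\<close> that assms nth_mem[OF that] by (auto simp: P_def order_le_less)
  moreover have "xs ! (i - 1) < x" if "0 < i"
  proof -
    have "\<not> P (i - 1)" using not_less_Least[of "i - 1" P] that by (simp add: i_def)
    then show ?thesis by (auto simp: P_def)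
  qed
  ultimately show thesis using that[of i] le by (simp add: piece_def)
qed

text \<open>Each piece is open and so contains no break points; at a separating point only the slopes of the two
  adjacent pieces matter. The equivalence serves both directions of the classification: from a map
  it gives distinct adjacent slopes, and from distinct adjacent slopes it gives the break points.\<close>

lemma break_points_eq_iff_distinct_adj:
  assumes sorted: "sorted_wrt (<) xs"
    and len: "length ss = length xs + 1"
    and cont: "\<And>x. isCont \<phi> x"
    and affine: "\<And>i. i \<le> length xs \<Longrightarrow> \<exists>c. \<forall>x \<in> piece xs i. \<phi> x = of_int (ss ! i) * x + c"
  shows "break_points \<phi> = set xs \<longleftrightarrow> distinct_adj ss"
proof -
  have sub: "break_points \<phi> \<subseteq> set xs"
  proof (rule subsetI, rule ccontr)
    fix x assume x: "x \<in> break_points \<phi>" and "x \<notin> set xs"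
    from this(2) obtain i where i: "i \<le> length xs" "x \<in> piece xs i" by (rule in_some_piece)
    obtain c where c: "\<forall>x \<in> piece xs i. \<phi> x = of_int (ss ! i) * x + c" using affine i(1) by blast
    have "eventually (\<lambda>y. y \<in> piece xs i) (nhds x)"
      using open_piece i(2) by (rule eventually_nhds_in_open)
    then have "eventually (\<lambda>y. \<phi> y = of_int (ss ! i) * y + c) (nhds x)"
      by (rule eventually_mono) (use c in blast)
    with x show False by (auto simp: break_points_def)
  qed
  have "xs ! i \<in> break_points \<phi> \<longleftrightarrow> ss ! i \<noteq> ss ! Suc i" if i: "i < length xs" for i
  proof -
    obtain c where c: "\<forall>x \<in> piece xs i. \<phi> x = of_int (ss ! i) * x + c"
      using affine[of i] i by auto
    obtain d where d: "\<forall>x \<in> piece xs (Suc i). \<phi> x = of_int (ss ! Suc i) * x + d"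
      using affine[of "Suc i"] i by auto
    have "eventually (\<lambda>y. \<phi> y = of_int (ss ! i) * y + c) (at_left (xs ! i))"
      using eventually_at_left_piece[OF sorted i] by (rule eventually_mono) (use c in blast)
    moreover have "eventually (\<lambda>y. \<phi> y = of_int (ss ! Suc i) * y + d) (at_right (xs ! i))"
      using eventually_at_right_piece[OF sorted i] by (rule eventually_mono) (use d in blast)
    ultimately show ?thesis
      using break_point_iff_slope_change[OF cont] by fastforce
  qed
  then have "set xs \<subseteq> break_points \<phi> \<longleftrightarrow> distinct_adj ss"
    using len by (auto simp: distinct_adj_conv_nth set_conv_nth)
  with sub show ?thesis by blast
qed

lemma distinct_adj_slope_sequence:
  assumes cont: "\<And>x. isCont \<phi> x" and ss: "has_slope_sequence \<phi> ss"
  shows "distinct_adj ss"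
proof -
  let ?xs = "sorted_list_of_set (break_points \<phi>)"
  have "break_points \<phi> = set ?xs" using ss by (simp add: has_slope_sequence_def)
  moreover have "break_points \<phi> = set ?xs \<longleftrightarrow> distinct_adj ss"
    by (rule break_points_eq_iff_distinct_adj) (use ss cont in \<open>simp_all add: has_slope_sequence_def\<close>)
  ultimately show ?thesis by blast
qed

lemma has_slope_sequenceI:
  assumes sorted: "sorted_wrt (<) xs"
    and len: "length ss = length xs + 1"
    and cont: "\<And>x. isCont \<phi> x"
    and affine: "\<And>i. i \<le> length xs \<Longrightarrow> \<exists>c. \<forall>x \<in> piece xs i. \<phi> x = of_int (ss ! i) * x + c"
    and adj: "distinct_adj ss"
  shows "has_slope_sequence \<phi> ss"
proof -
  have bp: "break_points \<phi> = set xs"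
    using break_points_eq_iff_distinct_adj[OF sorted len cont affine] adj by simp
  have "sorted xs" "distinct xs" using sorted by (simp_all add: strict_sorted_iff)
  then have "sorted_list_of_set (set xs) = xs" "card (set xs) = length xs"
    by (simp_all add: sorted_list_of_set.idem_if_sorted_distinct distinct_card)
  then show ?thesis using len affine by (simp add: has_slope_sequence_def bp)
qed

section \<open>Maps with prescribed slopes\<close>

text \<open>The kinks are placed at the integers \<open>1, \<dots>, k\<close>, where \<open>ss = [s\<^sub>0, \<dots>, s\<^sub>k]\<close>; the summand for \<open>j\<close> is
  the tropical building block that changes the slope from \<open>s\<^sub>j\<^sub>-\<^sub>1\<close> to \<open>s\<^sub>j\<close> at \<open>j\<close>.\<close>

definition pl_map :: "int list \<Rightarrow> real \<Rightarrow> real" where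
  "pl_map ss x = of_int (ss ! 0) * x +
     (\<Sum>j = 1..<length ss. of_int (ss ! j - ss ! (j - 1)) * max 0 (x - real j))"

lemma isCont_pl_map: "isCont (pl_map ss) x"
  unfolding pl_map_def by (intro continuous_intros)

text \<open>Between the kinks \<open>i\<close> and \<open>i + 1\<close> exactly the summands up to \<open>i\<close> are active, and their slopes
  telescope to \<open>s\<^sub>i - s\<^sub>0\<close>.\<close>

lemma pl_map_eq:
  assumes i: "i < length ss" and lo: "0 < i \<Longrightarrow> real i \<le> x"
    and hi: "Suc i < length ss \<Longrightarrow> x \<le> real (Suc i)"
  shows "pl_map ss x = of_int (ss ! i) * x - (\<Sum>j = 1..i. of_int (ss ! j - ss ! (j - 1)) * real j)"
proof -
  have "(\<Sum>j = 1..<length ss. of_int (ss ! j - ss ! (j - 1)) * max 0 (x - real j)) =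
      (\<Sum>j = 1..i. of_int (ss ! j - ss ! (j - 1)) * (x - real j))"
  proof (rule sum.mono_neutral_cong_right)
    show "\<forall>j \<in> {1..<length ss} - {1..i}. of_int (ss ! j - ss ! (j - 1)) * max 0 (x - real j) = 0"
    proof
      fix j assume j: "j \<in> {1..<length ss} - {1..i}"
      then have "x \<le> real (Suc i)" "real (Suc i) \<le> real j" using hi by auto
      then show "of_int (ss ! j - ss ! (j - 1)) * max 0 (x - real j) = 0" by simp
    qed
  next
    fix j assume j: "j \<in> {1..i}"
    then have "real i \<le> x" "real j \<le> real i" using lo by auto
    then show "of_int (ss ! j - ss ! (j - 1)) * max 0 (x - real j) =
        of_int (ss ! j - ss ! (j - 1)) * (x - real j)" by simp
  qed (use i in auto)
  also have "\<dots> = (\<Sum>j = 1..i. real_of_int (ss ! j - ss ! (j - 1))) * x -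
      (\<Sum>j = 1..i. of_int (ss ! j - ss ! (j - 1)) * real j)"
    by (simp only: right_diff_distrib sum_subtractf sum_distrib_right)
  also have "(\<Sum>j = 1..i. real_of_int (ss ! j - ss ! (j - 1))) = of_int (ss ! i) - of_int (ss ! 0)"
    by (induction i) auto
  finally show ?thesis unfolding pl_map_def by (simp only: left_diff_distrib)
qed

lemma has_slope_sequence_pl_map:
  assumes "ss \<noteq> []" "distinct_adj ss"
  shows "has_slope_sequence (pl_map ss) ss"
proof (rule has_slope_sequenceI)
  let ?xs = "map real [1..<length ss]"
  show "sorted_wrt (<) ?xs" by (simp add: sorted_wrt_map)
  show len: "length ss = length ?xs + 1" using assms(1) by (simp add: Suc_leI)
  fix i assume i: "i \<le> length ?xs"
  then have i': "i < length ss" using len by simp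
  have "pl_map ss x = of_int (ss ! i) * x + - (\<Sum>j = 1..i. of_int (ss ! j - ss ! (j - 1)) * real j)"
    if x: "x \<in> piece ?xs i" for x
  proof -
    have "real i \<le> x" if "0 < i" using x that i' by (auto simp: piece_def)
    moreover have "x \<le> real (Suc i)" if "Suc i < length ss" using x that by (auto simp: piece_def)
    ultimately show ?thesis using pl_map_eq[OF i'] by simp
  qed
  then show "\<exists>c. \<forall>x \<in> piece ?xs i. pl_map ss x = of_int (ss ! i) * x + c" by blast
qed (use assms isCont_pl_map in auto)

definition extend_ereal :: "(real \<Rightarrow> real) \<Rightarrow> ereal \<Rightarrow> ereal" where
  "extend_ereal \<phi> e = (case e of ereal r \<Rightarrow> ereal (\<phi> r) | PInfty \<Rightarrow> \<infinity> | MInfty \<Rightarrow> -\<infinity>)"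

lemma real_part_extend_ereal [simp]: "real_part (extend_ereal \<phi>) = \<phi>"
  by (rule ext) (simp add: real_part_def extend_ereal_def)

text \<open>Punctured neighbourhoods of \<open>\<infinity>\<close> and \<open>-\<infinity>\<close> in the extended reals are the images of the real filters
  \<open>at_top\<close> and \<open>at_bot\<close>, so continuity at the two ends is divergence of \<open>\<phi>\<close> there.\<close>

lemma continuous_on_extend_ereal:
  assumes cont: "\<And>x. isCont \<phi> x" and top: "filterlim \<phi> at_top at_top"
    and bot: "filterlim \<phi> at_bot at_bot"
  shows "continuous_on UNIV (extend_ereal \<phi>)"
  unfolding continuous_on_def
proof
  fix e :: ereal
  show "(extend_ereal \<phi> \<longlongrightarrow> extend_ereal \<phi> e) (at e)"
  proof (cases e)
    case (real r)
    have "((\<lambda>x. ereal (\<phi> x)) \<longlongrightarrow> ereal (\<phi> r)) (at r)"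
      using cont by (simp add: isCont_def)
    then show ?thesis by (simp add: real at_ereal filterlim_filtermap extend_ereal_def)
  next
    case PInf
    have "((\<lambda>x. ereal (\<phi> x)) \<longlongrightarrow> \<infinity>) at_top"
      using top by (simp add: tendsto_PInfty_eq_at_top)
    then show ?thesis
      by (simp add: PInf at_infty_ereal_eq_at_top filterlim_filtermap extend_ereal_def)
  next
    case MInf
    have "((\<lambda>x. ereal (\<phi> x)) \<longlongrightarrow> -\<infinity>) at_bot"
      using bot by (simp add: tendsto_MInfty filterlim_at_bot_dense)
    moreover have "at (-\<infinity> :: ereal) = at_right (-\<infinity>)"
      by (auto simp: at_within_def intro!: arg_cong[where f = "\<lambda>S. inf _ (principal S)"])
    ultimately show ?thesis
      by (simp add: MInf at_right_MInf filterlim_filtermap extend_ereal_def)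
  qed
qed

lemma filterlim_pl_map:
  assumes "ss \<noteq> []"
  shows "0 < last ss \<Longrightarrow> filterlim (pl_map ss) at_top at_top"
    and "0 < hd ss \<Longrightarrow> filterlim (pl_map ss) at_bot at_bot"
proof -
  let ?n = "length ss - 1"
  define C where "C = (\<Sum>j = 1..?n. of_int (ss ! j - ss ! (j - 1)) * real j)"
  have n: "?n < length ss" using assms by simp
  assume last: "0 < last ss"
  have "eventually (\<lambda>x. pl_map ss x = of_int (last ss) * x - C) at_top"
    using eventually_ge_at_top[of "real ?n"]
  proof (rule eventually_mono)
    fix x assume "real ?n \<le> x"
    then show "pl_map ss x = of_int (last ss) * x - C"
      using pl_map_eq[OF n] assms by (auto simp: C_def last_conv_nth)
  qed
  note cong = filterlim_cong[OF refl refl this]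
  have "filterlim (\<lambda>x. of_int (last ss) * x) at_top (at_top :: real filter)"
    by (rule filterlim_tendsto_pos_mult_at_top[OF tendsto_const _ filterlim_ident]) (use last in simp)
  from filterlim_tendsto_add_at_top[OF tendsto_const[of "- C"] this]
  have "filterlim (\<lambda>x. of_int (last ss) * x - C) at_top at_top"
    by (simp only: add.commute[of "- C"] diff_conv_add_uminus)
  then show "filterlim (pl_map ss) at_top at_top"
    by (simp only: cong)
next
  assume hd: "0 < hd ss"
  have "eventually (\<lambda>x. pl_map ss x = of_int (hd ss) * x) at_bot"
    using eventually_le_at_bot[of 1]
  proof (rule eventually_mono)
    fix x :: real assume "x \<le> 1"
    then show "pl_map ss x = of_int (hd ss) * x"
      using pl_map_eq[of 0 ss x] assms by (auto simp: hd_conv_nth)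
  qed
  note cong = filterlim_cong[OF refl refl this]
  have "filterlim (\<lambda>x. of_int (hd ss) * x) at_bot (at_bot :: real filter)"
    by (rule filterlim_tendsto_pos_mult_at_bot[OF tendsto_const _ filterlim_ident]) (use hd in simp)
  then show "filterlim (pl_map ss) at_bot at_bot"
    by (simp only: cong)
qed

section \<open>From maps of degree three to slope sequences\<close>

text \<open>In contrast to the definition of a tropical rational map, the distinctness of adjacent slopes is
  demanded explicitly: for the slopes of a map it comes from the break points, but here there is
  no map.\<close>

definition degree3_slopes :: "int list set" where
  "degree3_slopes = {ss. ss \<noteq> [] \<and> hd ss = 3 \<and> last ss = 3 \<and> distinct_adj ss \<and>
     (\<Sum>i = 1..<length ss. \<bar>ss ! i - ss ! (i - 1)\<bar>) = 4}"

lemma slope_sequence_degree3: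
  assumes "tropical_rational_map3 F"
  shows "slope_sequence F \<in> degree3_slopes"
    and "length (slope_sequence F) = card (break_points (real_part F)) + 1"
proof -
  from assms obtain ss where cont: "continuous_on UNIV F"
    and fin: "\<forall>x::real. F (ereal x) \<in> range ereal"
    and ss: "has_slope_sequence (real_part F) ss" "hd ss = 3" "last ss = 3"
      "(\<Sum>i = 1..<length ss. \<bar>ss ! i - ss ! (i - 1)\<bar>) = 4"
    unfolding tropical_rational_map3_def by blast
  have "isCont (real_part F) x" for x
  proof -
    have F: "F (ereal y) = ereal (real_part F y)" for y
    proof -
      obtain r where "F (ereal y) = ereal r" using fin by blast
      then show ?thesis by (simp add: real_part_def)
    qed
    have "(F \<longlongrightarrow> F (ereal x)) (at (ereal x))"
      using cont by (simp add: continuous_on_def)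
    then have "((\<lambda>y. F (ereal y)) \<longlongrightarrow> F (ereal x)) (at x)"
      by (simp add: at_ereal filterlim_filtermap)
    then show ?thesis by (simp add: F isCont_def)
  qed
  with ss(1) have "distinct_adj ss" by (rule distinct_adj_slope_sequence[rotated])
  moreover have len: "length ss = card (break_points (real_part F)) + 1"
    using ss(1) by (simp add: has_slope_sequence_def)
  ultimately show "slope_sequence F \<in> degree3_slopes"
    using ss by (auto simp: degree3_slopes_def slope_sequence_eq)
  show "length (slope_sequence F) = card (break_points (real_part F)) + 1"
    using ss len by (simp add: slope_sequence_eq)
qed

lemma degree3_slopes_realised:
  assumes "ss \<in> degree3_slopes"
  obtains F where "tropical_rational_map3 F" "slope_sequence F = ss"
proof
  let ?F = "extend_ereal (pl_map ss)"
  have "has_slope_sequence (real_part ?F) ss"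
    using assms has_slope_sequence_pl_map by (simp add: degree3_slopes_def)
  moreover have "continuous_on UNIV ?F"
    using assms by (intro continuous_on_extend_ereal isCont_pl_map filterlim_pl_map)
      (auto simp: degree3_slopes_def)
  ultimately show "tropical_rational_map3 ?F" "slope_sequence ?F = ss"
    using assms
    by (auto simp: tropical_rational_map3_def degree3_slopes_def extend_ereal_def slope_sequence_eq)
qed

text \<open>From here on no maps are involved: a combinatorial type is the reversal class of an admissible
  sequence, and the number of break points is one less than its length.\<close>

lemma types_eq_quotient:
  "combinatorial_type ` {F. tropical_rational_map3 F} = degree3_slopes // reversal_equiv"
  "types_with_breaks k = {ss \<in> degree3_slopes. length ss = k + 1} // reversal_equiv"
proof -
  have 1: "slope_sequence ` {F. tropical_rational_map3 F} = degree3_slopes"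
  proof (intro equalityI subsetI)
    fix ss assume "ss \<in> degree3_slopes"
    then obtain F where "tropical_rational_map3 F" "slope_sequence F = ss"
      by (rule degree3_slopes_realised)
    then show "ss \<in> slope_sequence ` {F. tropical_rational_map3 F}" by blast
  qed (auto simp: slope_sequence_degree3)
  have 2: "slope_sequence ` {F. tropical_rational_map3 F \<and> card (break_points (real_part F)) = k} =
      {ss \<in> degree3_slopes. length ss = k + 1}"
  proof (intro equalityI subsetI)
    fix ss assume "ss \<in> {ss \<in> degree3_slopes. length ss = k + 1}"
    then have ss: "ss \<in> degree3_slopes" and len: "length ss = k + 1" by simp_all
    from ss obtain F where F: "tropical_rational_map3 F" "slope_sequence F = ss"
      by (rule degree3_slopes_realised)
    then have "card (break_points (real_part F)) = k"
      using slope_sequence_degree3(2)[OF F(1)] len by simp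
    with F show "ss \<in> slope_sequence `
        {F. tropical_rational_map3 F \<and> card (break_points (real_part F)) = k}" by blast
  qed (auto simp: slope_sequence_degree3)
  have q: "combinatorial_type ` A = (slope_sequence ` A) // reversal_equiv" for A
    by (auto simp: combinatorial_type_def quotient_def)
  show "combinatorial_type ` {F. tropical_rational_map3 F} = degree3_slopes // reversal_equiv"
    by (simp only: q 1)
  show "types_with_breaks k = {ss \<in> degree3_slopes. length ss = k + 1} // reversal_equiv"
    by (simp only: types_with_breaks_def q 2)
qed

section \<open>Enumeration of the slope sequences\<close>

text \<open>Every jump contributes at least one to the total variation \<open>4\<close>, so there are at most four of them.
  A sequence from \<open>3\<close> to \<open>3\<close> with one jump or none has total variation \<open>0\<close>.\<close>

lemma length_degree3_slopes:
  assumes "ss \<in> degree3_slopes"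
  shows "length ss \<in> {3, 4, 5}"
proof -
  have adj: "ss ! i \<noteq> ss ! (i - 1)" if "i \<in> {1..<length ss}" for i
    using assms that by (auto simp: degree3_slopes_def distinct_adj_conv_nth dest!: spec[of _ "i - 1"])
  have "(\<Sum>i = 1..<length ss. 1) \<le> (\<Sum>i = 1..<length ss. \<bar>ss ! i - ss ! (i - 1)\<bar>)"
    by (rule sum_mono) (use adj in force)
  then have "length ss \<le> 5" using assms by (simp add: degree3_slopes_def)
  moreover have "length ss \<noteq> 0" "length ss \<noteq> 1"
    using assms by (auto simp: degree3_slopes_def)
  moreover have "length ss \<noteq> 2"
    using assms by (auto simp: degree3_slopes_def numeral_2_eq_2 length_Suc_conv)
  ultimately have "length ss = 3 \<or> length ss = 4 \<or> length ss = 5" by linarith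
  then show ?thesis by simp
qed

text \<open>For sequences of fixed length, membership unfolds to linear arithmetic with absolute values.\<close>

lemma list5_in_degree3_slopes:
  "[x, a, b, c, y] \<in> degree3_slopes \<longleftrightarrow>
     x = 3 \<and> y = 3 \<and> a \<noteq> 3 \<and> b \<noteq> a \<and> c \<noteq> b \<and> c \<noteq> 3 \<and> \<bar>a - 3\<bar> + \<bar>b - a\<bar> + \<bar>c - b\<bar> + \<bar>3 - c\<bar> = 4"
  by (auto simp: degree3_slopes_def sum.op_ivl_Suc)

lemma list4_in_degree3_slopes:
  "[x, a, b, y] \<in> degree3_slopes \<longleftrightarrow>
     x = 3 \<and> y = 3 \<and> a \<noteq> 3 \<and> b \<noteq> a \<and> b \<noteq> 3 \<and> \<bar>a - 3\<bar> + \<bar>b - a\<bar> + \<bar>3 - b\<bar> = 4"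
  by (auto simp: degree3_slopes_def sum.op_ivl_Suc)

lemma list3_in_degree3_slopes:
  "[x, a, y] \<in> degree3_slopes \<longleftrightarrow> x = 3 \<and> y = 3 \<and> a \<noteq> 3 \<and> \<bar>a - 3\<bar> + \<bar>3 - a\<bar> = 4"
  by (auto simp: degree3_slopes_def sum.op_ivl_Suc)

lemma degree3_slopes_two_breaks:
  "{ss \<in> degree3_slopes. length ss = 2 + 1} = {[3,5,3], [3,1,3]}"
proof (intro equalityI subsetI)
  fix ss assume "ss \<in> {ss \<in> degree3_slopes. length ss = 2 + 1}"
  then obtain x a y where "ss = [x, a, y]" "[x, a, y] \<in> degree3_slopes"
    by (auto simp: numeral_eq_Suc length_Suc_conv)
  moreover from this(2) have "a = 5 \<or> a = 1"
    unfolding list3_in_degree3_slopes by linarith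
  ultimately show "ss \<in> {[3,5,3], [3,1,3]}"
    by (auto simp: list3_in_degree3_slopes)
qed (auto simp: list3_in_degree3_slopes)

lemma degree3_slopes_three_breaks:
  "{ss \<in> degree3_slopes. length ss = 3 + 1} =
     {[3,5,4,3], [3,4,5,3], [3,1,2,3], [3,2,1,3], [3,4,2,3], [3,2,4,3]}"
proof (intro equalityI subsetI)
  fix ss assume "ss \<in> {ss \<in> degree3_slopes. length ss = 3 + 1}"
  then obtain x a b y where "ss = [x, a, b, y]" "[x, a, b, y] \<in> degree3_slopes"
    by (auto simp: numeral_eq_Suc length_Suc_conv)
  moreover from this(2)
  have "a = 5 \<and> b = 4 \<or> a = 4 \<and> b = 5 \<or> a = 1 \<and> b = 2 \<or> a = 2 \<and> b = 1 \<or> a = 4 \<and> b = 2 \<or> a = 2 \<and> b = 4"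
    unfolding list4_in_degree3_slopes by smt
  ultimately show "ss \<in> {[3,5,4,3], [3,4,5,3], [3,1,2,3], [3,2,1,3], [3,4,2,3], [3,2,4,3]}"
    by (auto simp: list4_in_degree3_slopes)
qed (auto simp: list4_in_degree3_slopes)

lemma degree3_slopes_four_breaks:
  "{ss \<in> degree3_slopes. length ss = 4 + 1} =
     {[3,4,5,4,3], [3,4,3,4,3], [3,4,3,2,3], [3,2,3,4,3], [3,2,3,2,3], [3,2,1,2,3]}"
proof (intro equalityI subsetI)
  fix ss assume "ss \<in> {ss \<in> degree3_slopes. length ss = 4 + 1}"
  then obtain x a b c y where "ss = [x, a, b, c, y]" "[x, a, b, c, y] \<in> degree3_slopes"
    by (auto simp: numeral_eq_Suc length_Suc_conv)
  moreover from this(2)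
  have "a = 4 \<and> b = 5 \<and> c = 4 \<or> a = 4 \<and> b = 3 \<and> c = 4 \<or> a = 4 \<and> b = 3 \<and> c = 2 \<or>
      a = 2 \<and> b = 3 \<and> c = 4 \<or> a = 2 \<and> b = 3 \<and> c = 2 \<or> a = 2 \<and> b = 1 \<and> c = 2"
    unfolding list5_in_degree3_slopes by smt
  ultimately show "ss \<in> {[3,4,5,4,3], [3,4,3,4,3], [3,4,3,2,3], [3,2,3,4,3], [3,2,3,2,3], [3,2,1,2,3]}"
    by (auto simp: list5_in_degree3_slopes)
qed (auto simp: list5_in_degree3_slopes)

text \<open>With classes written as explicit pairs, comparing two classes means comparing concrete lists.\<close>

lemma quotient_reversal_equiv: "A // reversal_equiv = (\<lambda>ss. {ss, rev ss}) ` A"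
  by (auto simp: quotient_def reversal_equiv_def)

theorem theorem1:
  "card (combinatorial_type ` {F. tropical_rational_map3 F}) = 10 \<and>
   combinatorial_type ` {F. tropical_rational_map3 F} =
     {[3,4,5,4,3], [3,4,3,4,3], [3,4,3,2,3], [3,2,3,2,3], [3,2,1,2,3],
      [3,5,4,3], [3,1,2,3], [3,4,2,3],
      [3,5,3], [3,1,3]} // reversal_equiv \<and>
   types_with_breaks 4 =
     {[3,4,5,4,3], [3,4,3,4,3], [3,4,3,2,3], [3,2,3,2,3], [3,2,1,2,3]} // reversal_equiv \<and>
   types_with_breaks 3 = {[3,5,4,3], [3,1,2,3], [3,4,2,3]} // reversal_equiv \<and>
   types_with_breaks 2 = {[3,5,3], [3,1,3]} // reversal_equiv"
proof -
  let ?A2 = "{[3,5,3], [3,1,3]} :: int list set"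
  let ?A3 = "{[3,5,4,3], [3,1,2,3], [3,4,2,3]} :: int list set"
  let ?A4 = "{[3,4,5,4,3], [3,4,3,4,3], [3,4,3,2,3], [3,2,3,2,3], [3,2,1,2,3]} :: int list set"
  let ?A = "{[3,4,5,4,3], [3,4,3,4,3], [3,4,3,2,3], [3,2,3,2,3], [3,2,1,2,3],
      [3,5,4,3], [3,1,2,3], [3,4,2,3], [3,5,3], [3,1,3]} :: int list set"
  \<comment> \<open>Each of the two sequences with two breaks is its own reversal; in the next two cases the
      sequences that are missing from the representatives are reversals of listed ones.\<close>
  have two: "types_with_breaks 2 = ?A2 // reversal_equiv"
    by (simp only: types_eq_quotient degree3_slopes_two_breaks)
  have three: "types_with_breaks 3 = ?A3 // reversal_equiv"
    unfolding types_eq_quotient degree3_slopes_three_breaks quotient_reversal_equiv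
    by (simp add: insert_commute)
  have four: "types_with_breaks 4 = ?A4 // reversal_equiv"
    unfolding types_eq_quotient degree3_slopes_four_breaks quotient_reversal_equiv
    by (simp add: insert_commute)
  have "degree3_slopes = {ss \<in> degree3_slopes. length ss = 4 + 1} \<union>
      {ss \<in> degree3_slopes. length ss = 3 + 1} \<union> {ss \<in> degree3_slopes. length ss = 2 + 1}"
    using length_degree3_slopes by fastforce
  then have "combinatorial_type ` {F. tropical_rational_map3 F} =
      types_with_breaks 4 \<union> types_with_breaks 3 \<union> types_with_breaks 2"
    unfolding types_eq_quotient quotient_reversal_equiv by (metis image_Un)
  also have "\<dots> = (?A4 \<union> ?A3 \<union> ?A2) // reversal_equiv"
    by (simp only: two three four quotient_reversal_equiv image_Un)
  also have "?A4 \<union> ?A3 \<union> ?A2 = ?A" by (simp only: Un_insert_left Un_empty_left)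
  finally have all: "combinatorial_type ` {F. tropical_rational_map3 F} = ?A // reversal_equiv" .
  have "card (?A // reversal_equiv) = 10"
    by (simp add: quotient_reversal_equiv doubleton_eq_iff)
  with all two three four show ?thesis by simp
qed

end
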